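(* The limit $\beta_0=\lim_{n\to\infty}\frac{\beta(G_{n,1/2})}{n}$ exists, $\beta_0\approx 0.672008$, and $\lim_{n\to\infty}\frac{\beta_{\mathrm{ev}}(n)}{n}=\beta_0$, i.e. $\beta_{\mathrm{ev}}(n)\sim\beta_0 n$.
   Context: All graphs are finite and simple. For a graph $H$ with clique counts $c_i(H)$ ($c_0=1$) and clique number $\omega(H)$, $PC(H,x)=\sum_{i=0}^{\omega(H)}(-1)^ic_i(H)x^{\omega(H)-i}$ and $\beta(H)$ is its largest real root. $\beta_{\mathrm{ev}}(n)=2^{-\binom n2}\sum_{G}\beta(G)$, the sum over all $2^{\binom n2}$ labelled graphs on a fixed $n$-element vertex set. For $p\in[0,1]$, $PC(G_{n,p},x)=\sum_{k=0}^{n}(-1)^k\binom nk p^{\binom k2}x^{n-k}$ (with $p^0=1$), and $\beta(G_{n,p})$ denotes its largest real root. *)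

theory Defs
  imports
    "HOL-Analysis.Analysis"
    "HOL-Computational_Algebra.Polynomial"
    "HOL-Library.Landau_Symbols"
begin

(* A graph is given by its vertex set V and its edge set E; an edge is a two-element set
   of vertices. *)
definition simple_graph :: "'a set \<Rightarrow> 'a set set \<Rightarrow> bool" where
  "simple_graph V E \<longleftrightarrow> finite V \<and> (\<forall>e\<in>E. e \<subseteq> V \<and> card e = 2)"

(* The empty set and the singletons of vertices are cliques. *)
definition clique :: "'a set \<Rightarrow> 'a set set \<Rightarrow> 'a set \<Rightarrow> bool" where
  "clique V E K \<longleftrightarrow> K \<subseteq> V \<and> (\<forall>x\<in>K. \<forall>y\<in>K. x \<noteq> y \<longrightarrow> {x, y} \<in> E)"

definition clique_count :: "'a set \<Rightarrow> 'a set set \<Rightarrow> nat \<Rightarrow> nat" where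
  "clique_count V E i = card {K. clique V E K \<and> card K = i}"

definition clique_number :: "'a set \<Rightarrow> 'a set set \<Rightarrow> nat" where
  "clique_number V E = Max {card K | K. clique V E K}"

definition PC :: "'a set \<Rightarrow> 'a set set \<Rightarrow> real poly" where
  "PC V E = (\<Sum>i=0..clique_number V E.
     monom ((-1) ^ i * real (clique_count V E i)) (clique_number V E - i))"

(* Meaningful for nonzero polynomials having a real root: Max is unspecified on the empty
   set and on infinite sets. *)
definition largest_real_root :: "real poly \<Rightarrow> real" where
  "largest_real_root p = Max {x. poly p x = 0}"

definition beta :: "'a set \<Rightarrow> 'a set set \<Rightarrow> real" where
  "beta V E = largest_real_root (PC V E)"

definition beta_ev :: "nat \<Rightarrow> real" where
  "beta_ev n = (\<Sum>E \<in> {E. simple_graph {..<n} E}. beta {..<n} E) / 2 ^ (n choose 2)"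

(* Defined from the expected clique counts of the random graph G(n,p); the edge probability p
   is meant to lie in [0,1]. *)
definition PC_Gnp :: "nat \<Rightarrow> real \<Rightarrow> real poly" where
  "PC_Gnp n p = (\<Sum>k=0..n. monom ((-1) ^ k * real (n choose k) * p ^ (k choose 2)) (n - k))"

definition beta_Gnp :: "nat \<Rightarrow> real \<Rightarrow> real" where
  "beta_Gnp n p = largest_real_root (PC_Gnp n p)"

end

theory Submission
  imports Defs
begin

text \<open>
  Write \<open>D(z) = \<Sum>\<^sub>K (-z)^|K|\<close>, summed over the cliques of a graph on \<open>n\<close> vertices; its least positive
  root is \<open>1/\<beta>(G)\<close>. Rescaled to \<open>D(z/n)\<close>, the mean of \<open>D\<close> over all graphs converges uniformly on
  \<open>[0,2]\<close> to the deformed exponential \<open>F(z) = \<Sum>\<^sub>k (-z)^k / (2^(k choose 2) k!)\<close>. Since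
  \<open>F'(z) = -F(z/2)\<close>, \<open>F\<close> decreases strictly on \<open>[0,2]\<close>, so its root \<open>\<zeta>\<close> there is stable under small
  perturbations, and \<open>\<beta>\<^sub>0 = 1/\<zeta>\<close>.

  Indicators of disjoint vertex sets being cliques are uncorrelated, so the \<open>k\<close>-th clique count has
  variance at most \<open>n (n-1 choose k-1)^2\<close>. Hence the mean over all graphs of
  \<open>\<Sum>\<^sub>k |c\<^sub>k - E c\<^sub>k| (2/n)^k\<close> is at most \<open>2 e\<^sup>2 / sqrt n\<close>. Where this deviation is small, \<open>\<beta>(G)/n\<close> is
  close to \<open>\<beta>\<^sub>0\<close>; elsewhere the bound \<open>0 \<le> \<beta>(G) \<le> n\<close> suffices.
\<close>

section \<open>The deformed exponential function\<close>

definition dexp_coeff :: "nat \<Rightarrow> real" where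
  "dexp_coeff k = 1 / (2 ^ (k choose 2) * fact k)"

definition dexp :: "real \<Rightarrow> real" where
  "dexp z = (\<Sum>k. dexp_coeff k * (- z) ^ k)"

lemma choose_two_Suc: "Suc k choose 2 = (k choose 2) + k"
  by (simp add: numeral_2_eq_2)

lemma dexp_coeff_pos: "dexp_coeff k > 0"
  by (simp add: dexp_coeff_def)

lemma dexp_coeff_Suc: "dexp_coeff (Suc k) = dexp_coeff k / (2 ^ k * (real k + 1))"
  by (simp add: dexp_coeff_def choose_two_Suc power_add field_simps)

lemma dexp_coeff_le: "dexp_coeff k \<le> 1 / fact k"
proof -
  have "1 / (2 ^ (k choose 2) * fact k) \<le> 1 / (1 * (fact k :: real))"
    by (intro divide_left_mono mult_right_mono) auto
  then show ?thesis by (simp add: dexp_coeff_def)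
qed

lemma summable_dexp_coeff: "summable (\<lambda>k. dexp_coeff k * x ^ k)"
proof (rule summable_comparison_test[OF _ summable_norm_exp[of x]], intro exI allI impI)
  fix k :: nat
  have "dexp_coeff k * \<bar>x\<bar> ^ k \<le> 1 / fact k * \<bar>x\<bar> ^ k"
    by (rule mult_right_mono[OF dexp_coeff_le]) simp
  then show "norm (dexp_coeff k * x ^ k) \<le> norm (x ^ k /\<^sub>R fact k)"
    using dexp_coeff_pos[of k] by (simp add: abs_mult power_abs field_simps)
qed

text \<open>Termwise differentiation replaces the \<open>n\<close>-th coefficient by itself divided
  by \<open>2 ^ n\<close>, and this factor is absorbed by halving the argument.\<close>

lemma dexp_has_derivative: "(dexp has_real_derivative - dexp (z / 2)) (at z)"
proof -
  have d: "diffs dexp_coeff n * (- z) ^ n = dexp_coeff n * (- (z / 2)) ^ n" for n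
  proof -
    have "diffs dexp_coeff n = dexp_coeff n / 2 ^ n"
      by (simp add: diffs_def dexp_coeff_Suc nonzero_divide_eq_eq add_nonneg_eq_0_iff field_simps)
    moreover have "(- (z / 2)) ^ n = (- z) ^ n / 2 ^ n"
      by (simp flip: power_divide)
    ultimately show ?thesis by simp
  qed
  have "((\<lambda>x. \<Sum>n. dexp_coeff n * x ^ n) has_real_derivative (\<Sum>n. diffs dexp_coeff n * (- z) ^ n))
      (at (- z))"
    by (rule termdiffs_strong_converges_everywhere[OF summable_dexp_coeff])
  then have "((\<lambda>x. \<Sum>n. dexp_coeff n * x ^ n) has_real_derivative dexp (z / 2)) (at (- z))"
    unfolding d dexp_def .
  then have "((\<lambda>z. \<Sum>n. dexp_coeff n * (- z) ^ n) has_real_derivative dexp (z / 2) * (- 1)) (at z)"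
    by (rule DERIV_chain2) (auto intro!: derivative_eq_intros)
  then show ?thesis by (simp add: dexp_def[abs_def])
qed

lemma continuous_dexp: "continuous_on A dexp"
  by (meson DERIV_isCont dexp_has_derivative continuous_at_imp_continuous_on)

text \<open>Consecutive terms have ratio \<open>z / (2 ^ k * (k + 1))\<close> in absolute value, so
  the bound on \<open>z\<close> makes them decrease from index \<open>m\<close> on. As
  \<open>m\<close> is even, the alternating tail begins with a nonnegative term and, by Leibniz,
  lies between 0 and that term.\<close>

lemma dexp_partial_sum_bounds:
  assumes "even m" and z: "0 \<le> z" "z \<le> 2 ^ m * (real m + 1)"
  shows "(\<Sum>k<m. dexp_coeff k * (- z) ^ k) \<le> dexp z"
    and "dexp z \<le> (\<Sum>k<Suc m. dexp_coeff k * (- z) ^ k)"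
proof -
  define a where "a k = dexp_coeff (k + m) * z ^ (k + m)" for k
  have a0: "a k \<ge> 0" for k using z dexp_coeff_pos[of "k + m"] by (simp add: a_def)
  have dec: "a (Suc k) \<le> a k" for k
  proof -
    have "2 ^ m * (real m + 1) \<le> 2 ^ (k + m) * (real (k + m) + 1)"
      by (intro mult_mono power_increasing) auto
    then have zk: "z / (2 ^ (k + m) * (real (k + m) + 1)) \<le> 1"
      using z by (simp add: divide_le_eq)
    have "a (Suc k) = a k * (z / (2 ^ (k + m) * (real (k + m) + 1)))"
      unfolding a_def using dexp_coeff_Suc[of "k + m"] by (simp add: add_ac)
    also have "\<dots> \<le> a k * 1" by (intro mult_left_mono zk a0)
    finally show ?thesis by simp
  qed
  have sa: "summable a" unfolding a_def
    using summable_dexp_coeff[of z] by (simp add: summable_iff_shift[of "\<lambda>k. dexp_coeff k * z ^ k"])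
  have alt: "(- 1) ^ k * a k = dexp_coeff (k + m) * (- z) ^ (k + m)" for k
    using \<open>even m\<close> by (simp add: a_def power_add power_minus[of z])
  have split: "dexp z = (\<Sum>k. (- 1) ^ k * a k) + (\<Sum>k<m. dexp_coeff k * (- z) ^ k)"
    unfolding dexp_def alt by (rule suminf_split_initial_segment[OF summable_dexp_coeff])
  note L = summable_Leibniz'(2,4)[OF summable_LIMSEQ_zero[OF sa] a0 dec]
  from L(1)[of 0] split show "(\<Sum>k<m. dexp_coeff k * (- z) ^ k) \<le> dexp z" by simp
  from L(2)[of 0] split alt[of 0]
  show "dexp z \<le> (\<Sum>k<Suc m. dexp_coeff k * (- z) ^ k)" by simp
qed

text \<open>The case \<open>m = 2\<close> of the alternating bounds; 12 is
  \<open>2 ^ 2 * (2 + 1)\<close>.\<close>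

lemma dexp_ge: "0 \<le> z \<Longrightarrow> z \<le> 12 \<Longrightarrow> 1 - z \<le> dexp z"
  using dexp_partial_sum_bounds(1)[of 2 z] by (simp add: dexp_coeff_def numeral_2_eq_2)

text \<open>Below 2 the derivative \<open>- dexp (t / 2)\<close> is negative, since
  \<open>dexp (t / 2)\<close> is at least \<open>1 - t / 2\<close>.\<close>

lemma dexp_strict_antimono:
  assumes "0 \<le> x" "x < y" "y \<le> 2"
  shows "dexp y < dexp x"
proof (rule DERIV_neg_imp_decreasing_open[OF assms(2)])
  fix t assume "x < t" "t < y"
  then have "dexp (t / 2) > 0" using dexp_ge[of "t / 2"] assms by simp
  then show "\<exists>d. (dexp has_real_derivative d) (at t) \<and> d < 0"
    using dexp_has_derivative[of t] by (intro exI[of _ "- dexp (t / 2)"]) simp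
qed (rule continuous_dexp)

lemma dexp_root:
  obtains \<zeta> where "0 < \<zeta>" "\<zeta> < 2" "\<bar>1 / \<zeta> - 0.672008\<bar> < 5 / 10 ^ 7" "dexp \<zeta> = 0"
proof -
  \<comment> \<open>The true value is \<open>0.67200754\<dots>\<close>, barely above the lower end of the admissible interval.\<close>
  let ?a = "1 / 0.6720085 :: real" and ?b = "1 / 0.6720075 :: real"
  \<comment> \<open>At \<open>m = 6\<close> the partial sum of degree 5 bounds \<open>dexp\<close>
    from below and that of degree 6 from above; both already have the required sign at the rational
    endpoints.\<close>
  have "0 < (\<Sum>k<6. dexp_coeff k * (- ?a) ^ k)"
    by (simp add: dexp_coeff_def eval_nat_numeral fact_numeral binomial_Suc_Suc)
  also have "\<dots> \<le> dexp ?a" by (rule dexp_partial_sum_bounds) simp_all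
  finally have a: "0 < dexp ?a" .
  have "dexp ?b \<le> (\<Sum>k<Suc 6. dexp_coeff k * (- ?b) ^ k)" by (rule dexp_partial_sum_bounds) simp_all
  also have "\<dots> < 0"
    by (simp add: dexp_coeff_def eval_nat_numeral fact_numeral binomial_Suc_Suc)
  finally have b: "dexp ?b < 0" .
  obtain \<zeta> where z: "?a \<le> \<zeta>" "\<zeta> \<le> ?b" "dexp \<zeta> = 0"
    using IVT2'[of dexp ?b 0 ?a] a b continuous_dexp by auto
  with a b have "?a < \<zeta>" "\<zeta> < ?b" by (metis less_eq_real_def less_irrefl)+
  then have "0 < \<zeta>" "\<zeta> < 2" "1 / \<zeta> < 0.6720085" "1 / \<zeta> > 0.6720075"
    by (auto simp: field_simps)
  moreover have "\<bar>w - 0.672008\<bar> < 5 / 10 ^ 7" if "w < 0.6720085" "w > 0.6720075" for w :: real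
    using that by (simp add: abs_if)
  ultimately show ?thesis using z(3) that by blast
qed

section \<open>Roots of clique polynomials\<close>

text \<open>Substituting \<open>z = 1 / x\<close> turns large roots of \<open>p\<close> into small
  positive roots of \<open>g\<close>. Positivity of \<open>g\<close> below \<open>a\<close> excludes
  roots of \<open>p\<close> above \<open>1 / a\<close>, and the sign change up to \<open>b\<close>
  yields a root of \<open>p\<close> at or above \<open>1 / b\<close>.\<close>

lemma largest_real_root_bounds:
  assumes p: "\<And>x. x > 0 \<Longrightarrow> poly p x = x ^ m * g (1 / x)"
    and pos: "\<And>z. 0 < z \<Longrightarrow> z < a \<Longrightarrow> g z > 0"
    and g: "continuous_on UNIV g" and "0 < a" "0 < b" "g b \<le> 0"
  shows "1 / b \<le> largest_real_root p" "largest_real_root p \<le> 1 / a"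
proof -
  have "a \<le> b" using pos[of b] assms by force
  have a2: "g (a / 2) > 0" using pos[of "a / 2"] \<open>0 < a\<close> by simp
  obtain r where r: "a / 2 \<le> r" "r \<le> b" "g r = 0"
    using IVT2'[of g b 0 "a / 2"] a2 \<open>g b \<le> 0\<close> \<open>a \<le> b\<close> \<open>0 < a\<close> continuous_on_subset[OF g, of "{a / 2..b}"]
    by auto
  then have "r > 0" using \<open>0 < a\<close> by simp
  then have root: "poly p (1 / r) = 0" using p[of "1 / r"] r by simp
  \<comment> \<open>This point shows that \<open>p\<close> is not the zero polynomial, so its root
    set is finite and \<open>Max\<close> is meaningful.\<close>
  have "poly p (2 / a) \<noteq> 0" using p[of "2 / a"] a2 \<open>0 < a\<close> by simp
  then have fin: "finite {x. poly p x = 0}" by (metis poly_0 poly_roots_finite)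
  have "1 / b \<le> 1 / r" using r \<open>r > 0\<close> by (simp add: frac_le)
  also have "\<dots> \<le> largest_real_root p"
    unfolding largest_real_root_def using fin root by (intro Max_ge) auto
  finally show "1 / b \<le> largest_real_root p" .
  have "x \<le> 1 / a" if "poly p x = 0" for x
  proof (rule ccontr)
    assume "\<not> x \<le> 1 / a"
    then have "1 / a < x" by simp
    moreover from this have "0 < x" using \<open>0 < a\<close> by (meson divide_pos_pos less_trans zero_less_one)
    ultimately have "1 / x < a" using \<open>0 < a\<close> by (simp add: field_simps)
    then show False using pos[of "1 / x"] p[of x] that \<open>0 < x\<close> by simp
  qed
  then show "largest_real_root p \<le> 1 / a"
    unfolding largest_real_root_def using fin root by (subst Max_le_iff) auto
qed

text \<open>This is the independence polynomial of the complement graph at \<open>- z\<close>.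
  Summing over cliques instead of sizes lets vertex deletion act directly on the index set.\<close>

definition clique_poly :: "'a set \<Rightarrow> 'a set set \<Rightarrow> real \<Rightarrow> real" where
  "clique_poly V E z = (\<Sum>K | clique V E K. (- z) ^ card K)"

lemma finite_cliques: "finite V \<Longrightarrow> finite {K. clique V E K}"
  by (rule finite_subset[of _ "Pow V"]) (auto simp: clique_def)

lemma continuous_clique_poly: "continuous_on A (clique_poly V E)"
  unfolding clique_poly_def[abs_def] by (intro continuous_intros)

lemma clique_poly_0:
  assumes "finite V"
  shows "clique_poly V E 0 = 1"
proof -
  have "clique_poly V E 0 = (\<Sum>K | clique V E K. if K = {} then 1 else 0)"
    unfolding clique_poly_def using assms
    by (intro sum.cong) (auto simp: clique_def card_gt_0_iff dest: finite_subset)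
  then show ?thesis using finite_cliques[OF assms, of E] by (simp add: clique_def)
qed

text \<open>The cliques containing \<open>v\<close> are exactly \<open>insert v L\<close> for a
  clique \<open>L\<close> in the neighbourhood of \<open>v\<close>, and \<open>v\<close> contributes
  one factor \<open>- z\<close>.\<close>

lemma clique_poly_remove_vertex:
  assumes "finite V" "v \<in> V"
  shows "clique_poly V E z =
    clique_poly (V - {v}) E z - z * clique_poly {u \<in> V - {v}. {u, v} \<in> E} E z"
proof -
  let ?N = "{u \<in> V - {v}. {u, v} \<in> E}"
  let ?C = "\<lambda>U. {K. clique U E K}"
  have "?C V = ?C (V - {v}) \<union> insert v ` ?C ?N"
  proof (intro equalityI subsetI)
    fix K assume K: "K \<in> ?C V"
    show "K \<in> ?C (V - {v}) \<union> insert v ` ?C ?N"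
    proof (cases "v \<in> K")
      case True
      then have "K = insert v (K - {v})" by auto
      moreover have "clique ?N E (K - {v})" using K True by (auto simp: clique_def)
      ultimately show ?thesis by blast
    qed (use K in \<open>auto simp: clique_def\<close>)
  next
    fix K assume "K \<in> ?C (V - {v}) \<union> insert v ` ?C ?N"
    then show "K \<in> ?C V"
    proof
      assume "K \<in> insert v ` ?C ?N"
      then obtain L where "K = insert v L" "clique ?N E L" by auto
      then show ?thesis using \<open>v \<in> V\<close> insert_commute[of v _ "{}"] by (auto simp: clique_def)
    qed (auto simp: clique_def)
  qed
  moreover have "?C (V - {v}) \<inter> insert v ` ?C ?N = {}" by (auto simp: clique_def)
  moreover have "finite (?C (V - {v}))" "finite (?C ?N)" using assms by (auto intro: finite_cliques)
  ultimately have "clique_poly V E z =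
      clique_poly (V - {v}) E z + (\<Sum>K\<in>insert v ` ?C ?N. (- z) ^ card K)"
    unfolding clique_poly_def by (simp add: sum.union_disjoint)
  also have "(\<Sum>K\<in>insert v ` ?C ?N. (- z) ^ card K) = (\<Sum>K\<in>?C ?N. (- z) ^ card (insert v K))"
  proof (rule sum.reindex_cong[of "insert v"])
    show "inj_on (insert v) (?C ?N)"
    proof (rule inj_onI)
      fix K L assume "K \<in> ?C ?N" "L \<in> ?C ?N" "insert v K = insert v L"
      moreover from this have "v \<notin> K" "v \<notin> L" by (auto simp: clique_def)
      ultimately show "K = L" by (simp add: insert_ident)
    qed
  qed auto
  also have "\<dots> = (\<Sum>K\<in>?C ?N. - z * (- z) ^ card K)"
  proof (rule sum.cong[OF refl])
    fix K assume "K \<in> ?C ?N"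
    then have "v \<notin> K" "finite K" using assms by (auto simp: clique_def intro: finite_subset)
    then show "(- z) ^ card (insert v K) = - z * (- z) ^ card K" by simp
  qed
  finally show ?thesis
    by (simp add: clique_poly_def sum_distrib_left sum_negf)
qed

text \<open>This excludes roots below \<open>1 / card V\<close>. In the deletion recurrence the
  neighbourhood value lies in [0,1] by induction, so each vertex lowers the value by an amount
  between 0 and \<open>z\<close>; the upper bound is part of the induction because it caps this
  loss.\<close>

lemma clique_poly_bounds:
  assumes "finite V" "0 \<le> z" "real (card V) * z \<le> 1"
  shows "1 - real (card V) * z \<le> clique_poly V E z \<and> clique_poly V E z \<le> 1"
  using assms
proof (induction "card V" arbitrary: V rule: less_induct)
  case less
  show ?case
  proof (cases "V = {}")
    case True
    moreover have "{K. clique {} E K} = {{}}" by (auto simp: clique_def)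
    ultimately show ?thesis by (simp add: clique_poly_def)
  next
    case False
    then obtain v where v: "v \<in> V" by blast
    let ?N = "{u \<in> V - {v}. {u, v} \<in> E}"
    have card: "card (V - {v}) < card V" using v less.prems(1) by (intro card_Diff1_less)
    moreover have le: "card ?N \<le> card (V - {v})" using less.prems(1) by (intro card_mono) auto
    ultimately have "card ?N < card V" by simp
    have mono: "real (card U) * z \<le> 1" if "card U < card V" for U :: "'a set"
      using that less.prems mult_right_mono[of "real (card U)" "real (card V)" z] by simp
    have 1: "1 - real (card (V - {v})) * z \<le> clique_poly (V - {v}) E z"
      "clique_poly (V - {v}) E z \<le> 1"
      using less.hyps[OF card] mono[OF card] less.prems by auto
    have "1 - real (card ?N) * z \<le> clique_poly ?N E z" and 2: "clique_poly ?N E z \<le> 1"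
      using less.hyps[OF \<open>card ?N < card V\<close>] mono[OF \<open>card ?N < card V\<close>] less.prems by auto
    then have 3: "0 \<le> clique_poly ?N E z" using mono[OF \<open>card ?N < card V\<close>] by simp
    have "real (card V) = real (card (V - {v})) + 1"
      using v less.prems(1) card by simp
    then have "real (card V) * z = real (card (V - {v})) * z + z" by (simp add: distrib_right)
    moreover have "0 \<le> z * clique_poly ?N E z" "z * clique_poly ?N E z \<le> z * 1"
      using mult_left_mono[OF 2 less.prems(2)] mult_nonneg_nonneg[OF less.prems(2) 3] by auto
    ultimately show ?thesis
      using clique_poly_remove_vertex[OF less.prems(1) v, of E z] 1 by linarith
  qed
qed

text \<open>
  Delete a vertex \<open>v\<close> and let \<open>r\<close> be the least root of \<open>V - {v}\<close>: below \<open>r\<close> the induction hypothesis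
  makes the neighbourhood of \<open>v\<close> positive, so the deletion recurrence gives a nonpositive value for \<open>V\<close>
  at \<open>r\<close>.
\<close>
lemma clique_poly_pos_subset:
  assumes "finite V" "\<And>z. 0 \<le> z \<Longrightarrow> z \<le> t \<Longrightarrow> clique_poly V E z > 0"
    and "U \<subseteq> V" "0 \<le> z" "z \<le> t"
  shows "clique_poly U E z > 0"
  using assms
proof (induction "card V" arbitrary: V U t z rule: less_induct)
  case less
  show ?case
  proof (cases "U = V")
    case True
    then show ?thesis using less.prems by simp
  next
    case False
    then obtain v where v: "v \<in> V" "v \<notin> U" using less.prems by blast
    let ?W = "V - {v}" and ?N = "{u \<in> V - {v}. {u, v} \<in> E}"
    have card: "card ?W < card V" using v less.prems(1) by (intro card_Diff1_less)
    have W: "clique_poly ?W E y > 0" if y: "0 \<le> y" "y \<le> t" for y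
    proof (rule ccontr)
      let ?B = "{x \<in> {0..t}. clique_poly ?W E x \<le> 0}"
      assume "\<not> ?thesis"
      then have "y \<in> ?B" using y by simp
      moreover have "compact ?B"
      proof -
        have "closed ({0..t} \<inter> clique_poly ?W E -` {..0})"
          by (intro continuous_closed_preimage continuous_clique_poly) auto
        moreover have "?B = {0..t} \<inter> clique_poly ?W E -` {..0}" by auto
        ultimately show ?thesis by (metis compact_Icc compact_Int_closed inf.left_idem)
      qed
      ultimately obtain r where r: "r \<in> ?B" "\<And>x. x \<in> ?B \<Longrightarrow> r \<le> x"
        using compact_attains_inf[of ?B] by blast
      have "r \<noteq> 0" using r(1) clique_poly_0[of ?W E] less.prems(1) by auto
      then have "r > 0" using r by auto
      have "clique_poly ?N E x > 0" if x: "0 \<le> x" "x < r" for x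
      proof (rule less.hyps[OF card])
        show "clique_poly ?W E u > 0" if "0 \<le> u" "u \<le> x" for u
          using r(2)[of u] that x r(1) by fastforce
      qed (use x less.prems in auto)
      \<comment> \<open>Positivity is available only strictly below \<open>r\<close>; continuity
        from the left still gives nonnegativity at \<open>r\<close>.\<close>
      moreover have "(clique_poly ?N E \<longlongrightarrow> clique_poly ?N E r) (at_left r)"
        using continuous_clique_poly[of UNIV ?N E]
        by (simp add: continuous_on_eq_continuous_at isCont_def filterlim_at_split)
      ultimately have N: "clique_poly ?N E r \<ge> 0"
        using \<open>r > 0\<close>
        by (intro tendsto_lowerbound[of "clique_poly ?N E" _ "at_left r"])
          (auto simp: eventually_at_left_field intro!: exI[of _ 0] less_imp_le)
      have "clique_poly V E r = clique_poly ?W E r - r * clique_poly ?N E r"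
        by (rule clique_poly_remove_vertex) (use v less.prems in auto)
      also have "\<dots> \<le> 0 - 0" using N r(1) \<open>r > 0\<close> by (intro diff_mono mult_nonneg_nonneg) auto
      finally show False using less.prems(2)[of r] r(1) by simp
    qed
    show ?thesis by (rule less.hyps[OF card _ W]) (use less.prems v in auto)
  qed
qed

text \<open>A single vertex has polynomial \<open>1 - z\<close>, which vanishes at 1. Since
  positivity passes to subsets, the polynomial of \<open>V\<close> cannot be positive on all of
  [0,1].\<close>

lemma clique_poly_nonpos:
  assumes "finite V" "V \<noteq> {}"
  obtains z where "0 < z" "z \<le> 1" "clique_poly V E z \<le> 0"
proof -
  obtain v where v: "v \<in> V" using assms by blast
  have "{K. clique {v} E K} = {{}, {v}}"
    by (auto simp: clique_def)
  then have "clique_poly {v} E 1 = 0" by (simp add: clique_poly_def)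
  then have "\<not> (\<forall>z. 0 \<le> z \<longrightarrow> z \<le> 1 \<longrightarrow> clique_poly V E z > 0)"
    using clique_poly_pos_subset[OF assms(1), of 1 E "{v}" 1] v by auto
  then obtain z where z: "0 \<le> z" "z \<le> 1" "clique_poly V E z \<le> 0"
    by (meson not_less)
  then have "z \<noteq> 0" using clique_poly_0[OF assms(1), of E] by auto
  then show ?thesis using that[of z] z by simp
qed

text \<open>The index set is left free because \<open>PC\<close> sums up to the clique number,
  whereas the comparison with the mean sums up to the number of vertices.\<close>

lemma clique_poly_eq_sum_counts:
  assumes "finite V" "card ` {K. clique V E K} \<subseteq> I" "finite I"
  shows "clique_poly V E z = (\<Sum>i\<in>I. real (clique_count V E i) * (- z) ^ i)"
proof -
  have "clique_poly V E z = (\<Sum>i\<in>I. \<Sum>K\<in>{K. K \<in> {K. clique V E K} \<and> card K = i}. (- z) ^ card K)"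
    unfolding clique_poly_def
    by (rule sum.group[symmetric]) (use assms finite_cliques in auto)
  also have "\<dots> = (\<Sum>i\<in>I. real (clique_count V E i) * (- z) ^ i)"
    by (intro sum.cong) (auto simp: clique_count_def)
  finally show ?thesis .
qed

lemma clique_poly_eq_sum_atMost:
  assumes "finite V"
  shows "clique_poly V E z = (\<Sum>i\<le>card V. real (clique_count V E i) * (- z) ^ i)"
  using assms by (intro clique_poly_eq_sum_counts) (auto simp: clique_def intro: card_mono)

lemma poly_PC:
  assumes "finite V" "x > 0"
  shows "poly (PC V E) x = x ^ clique_number V E * clique_poly V E (1 / x)"
proof -
  let ?w = "clique_number V E"
  have "clique_poly V E (1 / x) = (\<Sum>i\<in>{0..?w}. real (clique_count V E i) * (- (1 / x)) ^ i)"
  proof (rule clique_poly_eq_sum_counts[OF assms(1)])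
    have "{card K | K. clique V E K} = card ` {K. clique V E K}" by auto
    then show "card ` {K. clique V E K} \<subseteq> {0..?w}"
      unfolding clique_number_def using finite_cliques[OF assms(1), of E] by (auto intro: Max_ge)
  qed simp
  also have "x ^ ?w * \<dots> = (\<Sum>i=0..?w. (- 1) ^ i * real (clique_count V E i) * x ^ (?w - i))"
    unfolding sum_distrib_left
  proof (rule sum.cong[OF refl])
    fix i assume "i \<in> {0..?w}"
    then have "x ^ ?w = x ^ (?w - i) * x ^ i" by (simp flip: power_add)
    then show "x ^ ?w * (real (clique_count V E i) * (- (1 / x)) ^ i) =
        (- 1) ^ i * real (clique_count V E i) * x ^ (?w - i)"
      using assms(2) by (simp add: power_minus[of "1 / x"] power_divide)
  qed
  finally show ?thesis by (simp add: PC_def poly_sum poly_monom)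
qed

lemma beta_bounds:
  assumes "finite V" "V \<noteq> {}"
  shows "0 \<le> beta V E" "beta V E \<le> real (card V)"
proof -
  have n: "card V > 0" using assms by (simp add: card_gt_0_iff)
  obtain b where b: "0 < b" "b \<le> 1" "clique_poly V E b \<le> 0"
    using clique_poly_nonpos[OF assms] .
  have pos: "clique_poly V E z > 0" if "0 < z" "z < 1 / real (card V)" for z
    using clique_poly_bounds[OF assms(1), of z E] that n by (simp add: field_simps)
  have "1 / real (card V) > 0" using n by simp
  note * = largest_real_root_bounds[of "PC V E", OF poly_PC[OF assms(1)] pos continuous_clique_poly this b(1,3)]
  have "1 / b \<le> beta V E" "beta V E \<le> real (card V)"
    using *(1) *(2) by (simp_all add: beta_def)
  moreover have "0 \<le> 1 / b" using b(1) by simp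
  ultimately show "0 \<le> beta V E" "beta V E \<le> real (card V)" by linarith+
qed

section \<open>Concentration of clique counts\<close>

text \<open>The edge set of the complete graph on \<open>A\<close>. Being a clique becomes the
  inclusion \<open>pairs K \<subseteq> E\<close>, and the graphs on \<open>V\<close> become the
  subsets of \<open>pairs V\<close>.\<close>

definition pairs :: "'a set \<Rightarrow> 'a set set" where
  "pairs A = {e. e \<subseteq> A \<and> card e = 2}"

lemma finite_pairs: "finite A \<Longrightarrow> finite (pairs A)"
  by (simp add: pairs_def)

lemma card_pairs: "finite A \<Longrightarrow> card (pairs A) = card A choose 2"
  by (simp add: pairs_def n_subsets)

lemma simple_graph_iff: "finite V \<Longrightarrow> simple_graph V E \<longleftrightarrow> E \<in> Pow (pairs V)"
  by (auto simp: simple_graph_def pairs_def)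

lemma clique_iff_pairs: "clique V E K \<longleftrightarrow> K \<subseteq> V \<and> pairs K \<subseteq> E"
proof -
  have "(\<forall>x\<in>K. \<forall>y\<in>K. x \<noteq> y \<longrightarrow> {x, y} \<in> E) \<longleftrightarrow> pairs K \<subseteq> E"
  proof
    show "pairs K \<subseteq> E" if "\<forall>x\<in>K. \<forall>y\<in>K. x \<noteq> y \<longrightarrow> {x, y} \<in> E"
      using that by (auto simp: pairs_def card_2_iff)
    show "\<forall>x\<in>K. \<forall>y\<in>K. x \<noteq> y \<longrightarrow> {x, y} \<in> E" if "pairs K \<subseteq> E"
      using that by (auto simp: pairs_def intro!: subsetD[OF that])
  qed
  then show ?thesis by (simp add: clique_def)
qed

lemma card_supersets:
  assumes "finite M" "P \<subseteq> M"
  shows "real (card {E \<in> Pow M. P \<subseteq> E}) = 2 ^ card M / 2 ^ card P"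
proof -
  have "bij_betw (\<lambda>E. E - P) {E \<in> Pow M. P \<subseteq> E} (Pow (M - P))"
    by (rule bij_betw_byWitness[of _ "\<lambda>E. E \<union> P"]) (use assms in auto)
  then have "card {E \<in> Pow M. P \<subseteq> E} = 2 ^ card (M - P)"
    using assms by (simp add: bij_betw_same_card card_Pow)
  also have "card (M - P) = card M - card P"
    using assms by (intro card_Diff_subset) (auto intro: finite_subset)
  finally have "real (card {E \<in> Pow M. P \<subseteq> E}) = 2 ^ (card M - card P)" by simp
  also have "\<dots> = 2 ^ card M / 2 ^ card P"
    using assms by (intro power_diff card_mono) auto
  finally show ?thesis .
qed

lemma sum_indicator_supersets:
  assumes "finite M" "P \<subseteq> M"
  shows "(\<Sum>E\<in>Pow M. of_bool (P \<subseteq> E)) = (2 ^ card M / 2 ^ card P :: real)"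
proof -
  have "{E \<in> Pow M. P \<subseteq> E} = Pow M \<inter> {E. P \<subseteq> E}" by auto
  then show ?thesis using assms(1) card_supersets[OF assms] by (simp add: sum_of_bool_eq)
qed

text \<open>Removing \<open>v\<close> is injective on these sets. Only an inequality holds for
  \<open>k = 0\<close>: the family is empty, but truncated subtraction makes the bound 1.\<close>

lemma card_sets_containing_le:
  assumes "finite V" "v \<in> V"
  shows "card {A. A \<subseteq> V \<and> card A = k \<and> v \<in> A} \<le> (card V - 1) choose (k - 1)"
proof -
  have "card {A. A \<subseteq> V \<and> card A = k \<and> v \<in> A} \<le> card {B. B \<subseteq> V - {v} \<and> card B = k - 1}"
  proof (rule card_inj_on_le[of "\<lambda>A. A - {v}"])
    show "inj_on (\<lambda>A. A - {v}) {A. A \<subseteq> V \<and> card A = k \<and> v \<in> A}"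
      by (rule inj_on_inverseI[of _ "insert v"]) auto
    show "(\<lambda>A. A - {v}) ` {A. A \<subseteq> V \<and> card A = k \<and> v \<in> A} \<subseteq> {B. B \<subseteq> V - {v} \<and> card B = k - 1}"
      using assms by auto
  qed (use assms in auto)
  also have "\<dots> = (card V - 1) choose (k - 1)"
    using assms by (subst n_subsets) auto
  finally show ?thesis .
qed

text \<open>Disjoint vertex sets share no pair, so the two clique events depend on disjoint sets of
  edges and the covariance is 0. Otherwise the centred indicators are bounded by 1 in absolute
  value, and the trivial estimate suffices.\<close>

lemma sum_covariance_le:
  assumes "finite V" "A \<subseteq> V" "B \<subseteq> V" "card A = k" "card B = k"
  defines "q \<equiv> 1 / 2 ^ (k choose 2) :: real"
  shows "(\<Sum>E\<in>Pow (pairs V). (of_bool (pairs A \<subseteq> E) - q) * (of_bool (pairs B \<subseteq> E) - q))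
    \<le> 2 ^ card (pairs V) * of_bool (A \<inter> B \<noteq> {})"
proof (cases "A \<inter> B = {}")
  case True
  let ?M = "pairs V"
  have fin: "finite A" "finite B" using assms by (auto intro: finite_subset)
  have sub: "pairs A \<subseteq> ?M" "pairs B \<subseteq> ?M" using assms by (auto simp: pairs_def)
  have "pairs A \<inter> pairs B = pairs (A \<inter> B)" by (auto simp: pairs_def)
  also have "\<dots> = {}" unfolding True by (auto simp: pairs_def)
  finally have "pairs A \<inter> pairs B = {}" .
  then have card: "card (pairs A \<union> pairs B) = (k choose 2) + (k choose 2)"
    using fin assms by (simp add: card_Un_disjoint finite_pairs card_pairs)
  have "(\<Sum>E\<in>Pow ?M. (of_bool (pairs A \<subseteq> E) - q) * (of_bool (pairs B \<subseteq> E) - q))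
    = (\<Sum>E\<in>Pow ?M. of_bool (pairs A \<union> pairs B \<subseteq> E)) - q * (\<Sum>E\<in>Pow ?M. of_bool (pairs A \<subseteq> E))
      - q * (\<Sum>E\<in>Pow ?M. of_bool (pairs B \<subseteq> E)) + q * q * 2 ^ card ?M"
  proof -
    have "(of_bool (pairs A \<subseteq> E) - q) * (of_bool (pairs B \<subseteq> E) - q) =
        of_bool (pairs A \<union> pairs B \<subseteq> E) - q * of_bool (pairs A \<subseteq> E) - q * of_bool (pairs B \<subseteq> E) + q * q" for E
      by (simp add: of_bool_def left_diff_distrib right_diff_distrib)
    then show ?thesis
      using assms(1) by (simp add: sum.distrib sum_subtractf sum_distrib_left finite_pairs card_Pow)
  qed
  also have "\<dots> = 0"
  proof -
    note ind = sum_indicator_supersets[OF finite_pairs[OF assms(1)]]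
    have "pairs A \<union> pairs B \<subseteq> ?M" using sub by blast
    then show ?thesis
      using fin assms(4,5)
      unfolding ind[OF sub(1)] ind[OF sub(2)] ind[OF \<open>pairs A \<union> pairs B \<subseteq> ?M\<close>] card
      by (simp add: q_def card_pairs power_add)
  qed
  finally show ?thesis using True by simp
next
  case False
  have q: "0 \<le> q" "q \<le> 1" by (auto simp: q_def)
  have le: "\<bar>of_bool P - q\<bar> \<le> 1" for P using q by (cases P) auto
  have "(\<Sum>E\<in>Pow (pairs V). (of_bool (pairs A \<subseteq> E) - q) * (of_bool (pairs B \<subseteq> E) - q))
    \<le> (\<Sum>E\<in>Pow (pairs V). 1)"
  proof (rule sum_mono)
    fix E
    have "\<bar>(of_bool (pairs A \<subseteq> E) - q) * (of_bool (pairs B \<subseteq> E) - q)\<bar> \<le> 1 * 1"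
      unfolding abs_mult by (intro mult_mono le) auto
    then show "(of_bool (pairs A \<subseteq> E) - q) * (of_bool (pairs B \<subseteq> E) - q) \<le> 1" by simp
  qed
  then show ?thesis using False assms(1) by (simp add: finite_pairs card_Pow)
qed

text \<open>Expanding the square leaves only intersecting pairs of \<open>k\<close>-sets. Each such
  pair shares one of the \<open>card V\<close> vertices, and few \<open>k\<close>-sets contain a
  given vertex.\<close>

lemma sum_clique_count_variance_le:
  assumes "finite V"
  shows "(\<Sum>E\<in>Pow (pairs V). (real (clique_count V E k) - real (card V choose k) / 2 ^ (k choose 2))\<^sup>2)
    \<le> 2 ^ card (pairs V) * (real (card V) * real ((card V - 1) choose (k - 1)) ^ 2)"
proof -
  let ?M = "pairs V" and ?c = "(card V - 1) choose (k - 1)"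
  define S where "S = {A. A \<subseteq> V \<and> card A = k}"
  define q :: real where "q = 1 / 2 ^ (k choose 2)"
  define X where "X A E = of_bool (pairs A \<subseteq> E) - q" for A :: "'a set" and E
  have finS: "finite S" using assms by (simp add: S_def)
  have X: "real (clique_count V E k) - real (card V choose k) / 2 ^ (k choose 2) = (\<Sum>A\<in>S. X A E)" for E
  proof -
    have "{K. clique V E K \<and> card K = k} = {A \<in> S. pairs A \<subseteq> E}"
      by (auto simp: S_def clique_iff_pairs)
    then have "real (clique_count V E k) = (\<Sum>A\<in>S. of_bool (pairs A \<subseteq> E))"
      using finS by (simp add: clique_count_def sum_of_bool_eq Int_def)
    moreover have "card S = card V choose k" unfolding S_def by (rule n_subsets[OF assms])
    ultimately show ?thesis by (simp add: X_def sum_subtractf q_def)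
  qed
  have "(\<Sum>E\<in>Pow ?M. (\<Sum>A\<in>S. X A E)\<^sup>2) = (\<Sum>E\<in>Pow ?M. \<Sum>A\<in>S. \<Sum>B\<in>S. X A E * X B E)"
    by (simp add: power2_eq_square sum_product)
  also have "\<dots> = (\<Sum>A\<in>S. \<Sum>B\<in>S. \<Sum>E\<in>Pow ?M. X A E * X B E)"
    by (subst sum.swap, intro sum.cong refl, rule sum.swap)
  also have "\<dots> \<le> (\<Sum>A\<in>S. \<Sum>B\<in>S. 2 ^ card ?M * of_bool (A \<inter> B \<noteq> {}))"
    unfolding X_def q_def using assms by (intro sum_mono sum_covariance_le) (auto simp: S_def)
  \<comment> \<open>A union bound over common vertices: the new expression factors over
    \<open>A\<close> and \<open>B\<close>, so the double sum becomes a square for each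
    \<open>v\<close>.\<close>
  also have "\<dots> \<le> (\<Sum>A\<in>S. \<Sum>B\<in>S. 2 ^ card ?M * (\<Sum>v\<in>V. of_bool (v \<in> A) * of_bool (v \<in> B)))"
  proof (intro sum_mono mult_left_mono)
    fix A B assume "A \<in> S" "B \<in> S"
    show "of_bool (A \<inter> B \<noteq> {}) \<le> (\<Sum>v\<in>V. of_bool (v \<in> A) * of_bool (v \<in> B) :: real)"
    proof (cases "A \<inter> B = {}")
      case False
      then obtain v where v: "v \<in> A" "v \<in> B" by blast
      then have "v \<in> V" using \<open>A \<in> S\<close> by (auto simp: S_def)
      then have "of_bool (v \<in> A) * of_bool (v \<in> B) \<le> (\<Sum>v\<in>V. of_bool (v \<in> A) * of_bool (v \<in> B) :: real)"
        using assms by (intro member_le_sum) auto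
      then show ?thesis using v False by simp
    qed (simp add: sum_nonneg)
  qed simp
  also have "\<dots> = 2 ^ card ?M * (\<Sum>A\<in>S. \<Sum>B\<in>S. \<Sum>v\<in>V. of_bool (v \<in> A) * of_bool (v \<in> B))"
    by (simp only: sum_distrib_left)
  also have "(\<Sum>A\<in>S. \<Sum>B\<in>S. \<Sum>v\<in>V. of_bool (v \<in> A) * of_bool (v \<in> B) :: real)
      = (\<Sum>A\<in>S. \<Sum>v\<in>V. \<Sum>B\<in>S. of_bool (v \<in> A) * of_bool (v \<in> B))"
    by (rule sum.cong[OF refl sum.swap])
  also have "(\<Sum>A\<in>S. \<Sum>v\<in>V. \<Sum>B\<in>S. of_bool (v \<in> A) * of_bool (v \<in> B) :: real)
      = (\<Sum>v\<in>V. (\<Sum>A\<in>S. of_bool (v \<in> A))\<^sup>2)"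
    by (subst sum.swap) (simp add: power2_eq_square sum_product)
  also have "2 ^ card ?M * \<dots> \<le> 2 ^ card ?M * (\<Sum>v\<in>V. real ?c ^ 2)"
  proof (intro mult_left_mono sum_mono power_mono)
    fix v assume "v \<in> V"
    have "{A \<in> S. v \<in> A} = {A. A \<subseteq> V \<and> card A = k \<and> v \<in> A}" by (auto simp: S_def)
    then show "(\<Sum>A\<in>S. of_bool (v \<in> A)) \<le> real ?c"
      using card_sets_containing_le[OF assms \<open>v \<in> V\<close>, of k] finS
      by (simp add: sum_of_bool_eq Int_def)
  qed (auto simp: sum_nonneg)
  finally show ?thesis unfolding X by simp
qed

text \<open>Cauchy-Schwarz passes from the second moment to the first absolute moment.\<close>

lemma sum_clique_count_deviation_le:
  assumes "finite V"
  shows "(\<Sum>E\<in>Pow (pairs V). \<bar>real (clique_count V E k) - real (card V choose k) / 2 ^ (k choose 2)\<bar>)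
    \<le> 2 ^ card (pairs V) * (sqrt (real (card V)) * real ((card V - 1) choose (k - 1)))"
    (is "(\<Sum>E\<in>?P. \<bar>?d E\<bar>) \<le> ?r")
proof (rule power2_le_imp_le)
  have "(\<Sum>E\<in>?P. \<bar>?d E\<bar>)\<^sup>2 \<le> (\<Sum>E\<in>?P. \<bar>?d E\<bar>\<^sup>2) * card ?P"
    by (rule sum_squared_le_sum_of_squares)
  also have "\<dots> = (\<Sum>E\<in>?P. (?d E)\<^sup>2) * 2 ^ card (pairs V)"
    using assms by (simp add: card_Pow finite_pairs)
  also have "\<dots> \<le> 2 ^ card (pairs V) * (real (card V) * real ((card V - 1) choose (k - 1)) ^ 2) * 2 ^ card (pairs V)"
    by (intro mult_right_mono sum_clique_count_variance_le assms) simp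
  also have "\<dots> = ?r\<^sup>2"
    by (simp add: power2_eq_square)
  finally show "(\<Sum>E\<in>?P. \<bar>?d E\<bar>)\<^sup>2 \<le> ?r\<^sup>2" .
qed simp

text \<open>The weights \<open>(2 / n) ^ k\<close> dominate \<open>(z / n) ^ k\<close> for all
  \<open>z\<close> in [0,2], so one number controls the whole interval.\<close>

definition clique_deviation :: "nat \<Rightarrow> nat set set \<Rightarrow> real" where
  "clique_deviation n E = (\<Sum>k\<le>n.
     \<bar>real (clique_count {..<n} E k) - real (n choose k) / 2 ^ (k choose 2)\<bar> * (2 / real n) ^ k)"

text \<open>Since \<open>(n - 1 choose j) \<le> n ^ j / j!\<close>, the weight
  \<open>(2 / n) ^ (j + 1)\<close> leaves \<open>2 / sqrt n\<close> times \<open>2 ^ j / j!\<close>,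
  a term of the series of \<open>exp 2\<close>.\<close>

lemma sum_clique_deviation_le:
  assumes "n > 0"
  shows "(\<Sum>E\<in>Pow (pairs {..<n}). clique_deviation n E) \<le> 2 ^ (n choose 2) * (2 * exp 2 / sqrt (real n))"
proof -
  let ?P = "Pow (pairs {..<n})"
  define d where "d k E = \<bar>real (clique_count {..<n} E k) - real (n choose k) / 2 ^ (k choose 2)\<bar>" for k E
  \<comment> \<open>The index 0 needs separate treatment: the general deviation bound would
    contribute a factor \<open>sqrt n\<close> there, but the empty set is always the only clique of
    size 0.\<close>
  have d0: "d 0 E = 0" for E
  proof -
    have "{K. clique {..<n} E K \<and> card K = 0} = {{}}"
      by (auto simp: clique_def dest: finite_subset)
    then show ?thesis by (simp add: d_def clique_count_def numeral_2_eq_2)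
  qed
  have dS: "(\<Sum>E\<in>?P. d (Suc j) E) * (2 / real n) ^ Suc j
      \<le> 2 ^ (n choose 2) * (2 / sqrt (real n)) * (2 ^ j /\<^sub>R fact j)" for j
  proof -
    have "((n - 1) choose j) * fact j \<le> (n - 1) ^ j" by (rule binomial_fact_pow)
    also have "\<dots> \<le> n ^ j" by (rule power_mono) auto
    finally have "real ((n - 1) choose j) * fact j \<le> real n ^ j"
      by (metis of_nat_fact of_nat_le_iff of_nat_mult of_nat_power)
    then have c: "real ((n - 1) choose j) \<le> real n ^ j / fact j" by (simp add: field_simps)
    have "(\<Sum>E\<in>?P. d (Suc j) E) \<le> 2 ^ (n choose 2) * (sqrt (real n) * real ((n - 1) choose j))"
      using sum_clique_count_deviation_le[of "{..<n}" "Suc j"] by (simp add: d_def card_pairs)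
    also have "\<dots> \<le> 2 ^ (n choose 2) * (sqrt (real n) * (real n ^ j / fact j))"
      using c by (intro mult_left_mono) auto
    finally have "(\<Sum>E\<in>?P. d (Suc j) E) * (2 / real n) ^ Suc j \<le>
        2 ^ (n choose 2) * (sqrt (real n) * (real n ^ j / fact j)) * (2 / real n) ^ Suc j"
      by (rule mult_right_mono) simp
    also have "\<dots> = 2 ^ (n choose 2) * 2 * (sqrt (real n) / real n) * (2 ^ j /\<^sub>R fact j)"
      using assms by (simp add: power_divide divide_simps)
    also have "sqrt (real n) / real n = 1 / sqrt (real n)"
      using assms by (simp add: real_div_sqrt divide_eq_eq)
    finally show ?thesis by simp
  qed
  have "(\<Sum>E\<in>?P. clique_deviation n E) = (\<Sum>k\<le>n. (\<Sum>E\<in>?P. d k E) * (2 / real n) ^ k)"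
    unfolding clique_deviation_def d_def sum_distrib_right by (rule sum.swap)
  also have "\<dots> = (\<Sum>j<n. (\<Sum>E\<in>?P. d (Suc j) E) * (2 / real n) ^ Suc j)"
    by (simp add: sum.atMost_shift d0)
  also have "\<dots> \<le> (\<Sum>j<n. 2 ^ (n choose 2) * (2 / sqrt (real n)) * (2 ^ j /\<^sub>R fact j))"
    by (rule sum_mono[OF dS])
  also have "\<dots> = 2 ^ (n choose 2) * (2 / sqrt (real n)) * (\<Sum>j<n. 2 ^ j /\<^sub>R fact j)"
    by (simp only: sum_distrib_left)
  also have "\<dots> \<le> 2 ^ (n choose 2) * (2 / sqrt (real n)) * exp 2"
    unfolding exp_def by (intro mult_left_mono sum_le_suminf) (auto intro: summable_exp)
  finally show ?thesis by simp
qed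

section \<open>Passage to the limit\<close>

text \<open>The mean of \<open>clique_poly\<close> over all graphs on \<open>n\<close> vertices, a
  given \<open>k\<close>-set being a clique in a fraction \<open>1 / 2 ^ (k choose 2)\<close> of
  them.\<close>

definition mean_clique_poly :: "nat \<Rightarrow> real \<Rightarrow> real" where
  "mean_clique_poly n z = (\<Sum>k\<le>n. real (n choose k) / 2 ^ (k choose 2) * (- z) ^ k)"

lemma poly_PC_Gnp_half:
  assumes "x > 0"
  shows "poly (PC_Gnp n (1/2)) x = x ^ n * mean_clique_poly n (1 / x)"
proof -
  have "x ^ n * mean_clique_poly n (1 / x) =
      (\<Sum>k\<le>n. (- 1) ^ k * real (n choose k) * (1/2) ^ (k choose 2) * x ^ (n - k))"
    unfolding mean_clique_poly_def sum_distrib_left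
  proof (rule sum.cong[OF refl])
    fix k assume "k \<in> {..n}"
    then have "x ^ n = x ^ (n - k) * x ^ k" by (simp flip: power_add)
    then show "x ^ n * (real (n choose k) / 2 ^ (k choose 2) * (- (1 / x)) ^ k) =
        (- 1) ^ k * real (n choose k) * (1/2) ^ (k choose 2) * x ^ (n - k)"
      using assms by (simp add: power_minus[of "1 / x"] power_divide)
  qed
  then show ?thesis by (simp add: PC_Gnp_def poly_sum poly_monom atMost_atLeast0)
qed

lemma continuous_mean_clique_poly: "continuous_on A (mean_clique_poly n)"
  unfolding mean_clique_poly_def[abs_def] by (intro continuous_intros)

lemma binomial_over_power_tendsto: "(\<lambda>n. real (n choose k) / real n ^ k) \<longlonglongrightarrow> 1 / fact k"
proof -
  have "(\<lambda>n. (\<Prod>i=0..<k. 1 - real i / real n) / fact k) \<longlonglongrightarrow> (\<Prod>i=0..<k. 1 - 0) / fact k"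
    by (intro tendsto_divide tendsto_prod tendsto_diff tendsto_const lim_const_over_n) auto
  moreover have "\<forall>\<^sub>F n in sequentially.
      (\<Prod>i=0..<k. 1 - real i / real n) / fact k = real (n choose k) / real n ^ k"
    using eventually_gt_at_top[of 0]
  proof eventually_elim
    case (elim n)
    have "(\<Prod>i=0..<k. real n - real i) = real n ^ k * (\<Prod>i=0..<k. 1 - real i / real n)"
    proof -
      have "(\<Prod>i=0..<k. real n - real i) = (\<Prod>i=0..<k. real n * (1 - real i / real n))"
        using elim by (intro prod.cong) (auto simp: right_diff_distrib)
      then show ?thesis by (simp add: prod.distrib)
    qed
    moreover have "real (n choose k) = (\<Prod>i=0..<k. real n - real i) / fact k"
      by (simp only: binomial_gbinomial gbinomial_prod_rev)
    ultimately show ?case using elim by simp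
  qed
  ultimately have "(\<lambda>n. real (n choose k) / real n ^ k) \<longlonglongrightarrow> (\<Prod>i=0..<k. 1 - 0) / fact k"
    by (rule Lim_transform_eventually)
  then show ?thesis by simp
qed

lemma binomial_over_power_le: "real (n choose k) / real n ^ k \<le> 1 / fact k"
proof (cases "real n ^ k = 0")
  case False
  moreover have "real n ^ k \<ge> 0" by simp
  ultimately have "real n ^ k > 0" by linarith
  moreover have "real (n choose k) * fact k \<le> real n ^ k"
    using binomial_fact_pow[of n k] by (metis of_nat_fact of_nat_le_iff of_nat_mult of_nat_power)
  ultimately show ?thesis by (simp add: pos_divide_le_eq pos_le_divide_eq)
next
  case True
  \<comment> \<open>Here \<open>n = 0\<close> and \<open>k > 0\<close>, and division by zero returns
    0.\<close>
  then have zero: "real (n choose k) / real n ^ k = 0" by (simp only: div_by_0)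
  show ?thesis unfolding zero by simp
qed

text \<open>The coefficients converge one by one, and their errors times \<open>2 ^ k\<close> are
  dominated by the summable \<open>2 ^ k / k!\<close>. Tannery's theorem sends the sum of these
  errors to 0, and that sum bounds the difference for every \<open>z\<close> in [0,2].\<close>

lemma mean_clique_poly_uniform_limit:
  assumes "\<epsilon> > 0"
  shows "\<forall>\<^sub>F n in sequentially. \<forall>z\<in>{0..2}. \<bar>mean_clique_poly n (z / real n) - dexp z\<bar> < \<epsilon>"
proof -
  define b where "b k n = real (n choose k) / 2 ^ (k choose 2) / real n ^ k" for k n
  define a where "a k n = \<bar>b k n - dexp_coeff k\<bar> * 2 ^ k" for k n
  have "(\<lambda>n. b k n) \<longlonglongrightarrow> dexp_coeff k" for k
    using tendsto_divide[OF binomial_over_power_tendsto[of k] tendsto_const[of "2 ^ (k choose 2)"]]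
    by (simp add: b_def dexp_coeff_def mult.commute)
  then have lim: "(\<lambda>n. a k n) \<longlonglongrightarrow> 0" for k
    unfolding a_def using LIM_zero tendsto_rabs_zero tendsto_mult_left_zero by blast
  have b: "0 \<le> b k n" "b k n \<le> 1 / fact k" for k n
  proof -
    have "b k n = (real (n choose k) / real n ^ k) / 2 ^ (k choose 2)" by (simp add: b_def)
    also have "\<dots> \<le> (1 / fact k) / 1"
      by (intro frac_le binomial_over_power_le) auto
    finally show "b k n \<le> 1 / fact k" by simp
  qed (simp add: b_def)
  have le: "norm (a k n) \<le> inverse (fact k) * 2 ^ k" for k n
  proof -
    have "\<bar>b k n - dexp_coeff k\<bar> \<le> 1 / fact k"
      using b[of k n] dexp_coeff_pos[of k] dexp_coeff_le[of k] by (simp add: abs_le_iff)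
    from mult_right_mono[OF this, of "2 ^ k"] show ?thesis by (simp add: a_def abs_mult inverse_eq_divide)
  qed
  have sum_a: "summable (\<lambda>k. a k n)" for n
    by (rule summable_comparison_test[OF _ summable_exp[of 2]]) (use le in blast)
  have "(\<lambda>n. \<Sum>k. a k n) \<longlonglongrightarrow> (\<Sum>k. 0)"
    by (rule tannerys_theorem[THEN conjunct2, THEN conjunct2, OF lim _ summable_exp[of 2]])
      (use le in \<open>auto simp: case_prod_unfold\<close>)
  then have "\<forall>\<^sub>F n in sequentially. (\<Sum>k. a k n) < \<epsilon>"
    using assms by (auto dest: order_tendstoD(2))
  then show ?thesis
  proof eventually_elim
    case (elim n)
    show ?case
    proof
      fix z :: real assume z: "z \<in> {0..2}"
      \<comment> \<open>The finite sum is an infinite series because the binomial coefficients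
        vanish beyond \<open>n\<close>.\<close>
      have "(\<lambda>k. b k n * (- z) ^ k) sums (\<Sum>k\<le>n. b k n * (- z) ^ k)"
        by (rule sums_finite) (auto simp: b_def)
      moreover have "(\<Sum>k\<le>n. b k n * (- z) ^ k) = mean_clique_poly n (z / real n)"
        unfolding mean_clique_poly_def b_def
        by (intro sum.cong refl) (simp add: power_minus[of z] power_minus[of "z / real n"] power_divide)
      moreover have "(\<lambda>k. dexp_coeff k * (- z) ^ k) sums dexp z"
        unfolding dexp_def by (rule summable_sums[OF summable_dexp_coeff])
      ultimately have "(\<lambda>k. b k n * (- z) ^ k - dexp_coeff k * (- z) ^ k) sums
          (mean_clique_poly n (z / real n) - dexp z)"
        using sums_diff by force
      then have s: "(\<lambda>k. (b k n - dexp_coeff k) * (- z) ^ k) sums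
          (mean_clique_poly n (z / real n) - dexp z)"
        by (simp add: left_diff_distrib)
      have "norm ((b k n - dexp_coeff k) * (- z) ^ k) \<le> a k n" for k
        unfolding a_def norm_mult norm_power using z by (intro mult_mono power_mono) auto
      then have "norm (\<Sum>k. (b k n - dexp_coeff k) * (- z) ^ k) \<le> (\<Sum>k. a k n)"
        by (rule norm_suminf_le) (rule sum_a)
      then show "\<bar>mean_clique_poly n (z / real n) - dexp z\<bar> < \<epsilon>"
        using s elim by (simp add: sums_iff)
    qed
  qed
qed

lemma clique_poly_near_mean:
  assumes "z \<in> {0..2}"
  shows "\<bar>clique_poly {..<n} E (z / real n) - mean_clique_poly n (z / real n)\<bar> \<le> clique_deviation n E"
proof -
  define d where "d k = real (clique_count {..<n} E k) - real (n choose k) / 2 ^ (k choose 2)" for k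
  have "clique_poly {..<n} E (z / real n) - mean_clique_poly n (z / real n) = (\<Sum>k\<le>n. d k * (- (z / real n)) ^ k)"
    by (simp add: clique_poly_eq_sum_atMost mean_clique_poly_def d_def left_diff_distrib sum_subtractf)
  also have "\<bar>\<dots>\<bar> \<le> (\<Sum>k\<le>n. \<bar>d k * (- (z / real n)) ^ k\<bar>)" by (rule sum_abs)
  also have "\<dots> \<le> (\<Sum>k\<le>n. \<bar>d k\<bar> * (2 / real n) ^ k)"
  proof -
    have "\<bar>- (z / real n)\<bar> \<le> 2 / real n" using assms by (simp add: divide_right_mono)
    then show ?thesis
      unfolding abs_mult power_abs by (intro sum_mono mult_left_mono power_mono) simp_all
  qed
  finally show ?thesis by (simp add: clique_deviation_def d_def)
qed

text \<open>Stability of the root: \<delta> depends only on \<zeta> and \<epsilon>, so the same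
  value serves every \<open>n\<close>, the averaged polynomial and every single graph.\<close>

lemma largest_real_root_near:
  assumes \<zeta>: "0 < \<zeta>" "\<zeta> < 2" "dexp \<zeta> = 0" and "\<epsilon> > 0"
  obtains \<delta> where "\<delta> > 0"
    "\<And>n p m g. n > 0 \<Longrightarrow> (\<And>x. x > 0 \<Longrightarrow> poly p x = x ^ m * g (1 / x)) \<Longrightarrow> continuous_on UNIV g \<Longrightarrow>
      (\<And>z. z \<in> {0..2} \<Longrightarrow> \<bar>g (z / real n) - dexp z\<bar> < \<delta>) \<Longrightarrow>
      \<bar>largest_real_root p / real n - 1 / \<zeta>\<bar> \<le> \<epsilon>"
proof -
  \<comment> \<open>The point \<open>a\<close> satisfies
    \<open>1 / a = 1 / \<zeta> + \<epsilon>\<close>. The point \<open>b\<close> exceeds \<zeta> by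
    at most \<open>\<epsilon> * \<zeta>\<^sup>2\<close>, which keeps \<open>1 / b\<close> within
    \<epsilon> of \<open>1 / \<zeta>\<close>; the cap 2 stays where \<open>dexp\<close> is known to
    decrease.\<close>
  define a where "a = 1 / (1 / \<zeta> + \<epsilon>)"
  define b where "b = min 2 (\<zeta> + \<epsilon> * \<zeta>\<^sup>2)"
  have den: "1 / \<zeta> + \<epsilon> > 0" using assms by (simp add: add_pos_pos)
  have "1 / (1 / \<zeta> + \<epsilon>) < 1 / (1 / \<zeta>)"
    using assms den by (intro divide_strict_left_mono) auto
  then have a: "0 < a" "a < \<zeta>" using den by (simp_all add: a_def)
  have b: "\<zeta> < b" "b \<le> 2" using assms by (auto simp: b_def)
  have "1 / \<zeta> - 1 / b = (b - \<zeta>) / (\<zeta> * b)" using b \<zeta> by (simp add: field_simps)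
  also have "\<dots> \<le> (\<epsilon> * \<zeta>\<^sup>2) / (\<zeta> * \<zeta>)" using b \<zeta> by (intro frac_le mult_left_mono) (auto simp: b_def)
  also have "\<dots> = \<epsilon>" using \<zeta> by (simp add: power2_eq_square)
  finally have b2: "1 / \<zeta> - 1 / b \<le> \<epsilon>" .
  define \<delta> where "\<delta> = min (dexp a) (- dexp b)"
  have "dexp a > 0" using dexp_strict_antimono[of a \<zeta>] a \<zeta> by simp
  moreover have "dexp b < 0" using dexp_strict_antimono[of \<zeta> b] b \<zeta> by simp
  ultimately have "\<delta> > 0" by (simp add: \<delta>_def)
  moreover have "\<bar>largest_real_root p / real n - 1 / \<zeta>\<bar> \<le> \<epsilon>"
    if n: "n > 0" and p: "\<And>x. x > 0 \<Longrightarrow> poly p x = x ^ m * g (1 / x)"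
      and g: "continuous_on UNIV g" and near: "\<And>z. z \<in> {0..2} \<Longrightarrow> \<bar>g (z / real n) - dexp z\<bar> < \<delta>"
    for n p m g
  proof -
    have pos: "g y > 0" if y: "0 < y" "y < a / real n" for y
    proof -
      let ?z = "y * real n"
      have z: "0 \<le> ?z" "?z < a" using y n by (auto simp: field_simps)
      then have "dexp a < dexp ?z" using a b by (intro dexp_strict_antimono) auto
      moreover have "\<bar>g (?z / real n) - dexp ?z\<bar> < \<delta>" using z a \<zeta> by (intro near) auto
      moreover have "\<delta> \<le> dexp a" "?z / real n = y" using n by (simp_all add: \<delta>_def)
      ultimately show ?thesis by simp
    qed
    have "\<bar>g (b / real n) - dexp b\<bar> < \<delta>" using b \<zeta> by (intro near) auto
    moreover have "\<delta> \<le> - dexp b" by (simp add: \<delta>_def)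
    ultimately have nonpos: "g (b / real n) \<le> 0" by linarith
    have "0 < a / real n" "0 < b / real n" using a b n \<zeta> by auto
    note bounds = largest_real_root_bounds[OF p pos g this nonpos]
    have "1 / (b / real n) / real n \<le> largest_real_root p / real n"
      "largest_real_root p / real n \<le> 1 / (a / real n) / real n"
      by (intro divide_right_mono bounds; simp)+
    moreover have "1 / (b / real n) / real n = 1 / b" "1 / (a / real n) / real n = 1 / \<zeta> + \<epsilon>"
      using n by (simp_all add: a_def)
    ultimately have "1 / b \<le> largest_real_root p / real n" "largest_real_root p / real n \<le> 1 / \<zeta> + \<epsilon>"
      by simp_all
    then show ?thesis using b2 by (simp add: abs_le_iff)
  qed
  ultimately show ?thesis by (rule that)
qed

text \<open>A bound linear in the deviation can be averaged over all graphs at once, so the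
  exceptional graphs are never counted separately.\<close>

lemma beta_ev_near:
  assumes "n > 0" and near: "\<And>E. \<bar>beta {..<n} E / real n - x\<bar> \<le> \<epsilon> + c * clique_deviation n E"
    and "c \<ge> 0"
  shows "\<bar>beta_ev n / real n - x\<bar> \<le> \<epsilon> + c * (2 * exp 2 / sqrt (real n))"
proof -
  let ?P = "Pow (pairs {..<n})" and ?N = "2 ^ (n choose 2) :: real"
  have card: "real (card ?P) = ?N" by (simp add: card_Pow finite_pairs card_pairs)
  have graphs: "{E. simple_graph {..<n} E} = ?P" using simple_graph_iff[of "{..<n}"] by blast
  have "beta_ev n / real n - x = (\<Sum>E\<in>?P. beta {..<n} E / real n - x) / ?N"
    using card unfolding beta_ev_def graphs
    by (simp add: sum_subtractf sum_divide_distrib[symmetric] diff_divide_distrib mult.commute)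
  also have "\<bar>\<dots>\<bar> \<le> (\<Sum>E\<in>?P. \<bar>beta {..<n} E / real n - x\<bar>) / ?N"
    by (simp add: divide_right_mono sum_abs)
  also have "\<dots> \<le> (\<Sum>E\<in>?P. \<epsilon> + c * clique_deviation n E) / ?N"
    by (intro divide_right_mono sum_mono near) simp
  also have "\<dots> = \<epsilon> + c * (\<Sum>E\<in>?P. clique_deviation n E) / ?N"
    using card by (simp add: sum.distrib sum_distrib_left[symmetric] add_divide_distrib)
  also have "\<dots> \<le> \<epsilon> + c * (?N * (2 * exp 2 / sqrt (real n))) / ?N"
    using assms by (intro add_left_mono divide_right_mono mult_left_mono sum_clique_deviation_le) auto
  finally show ?thesis by simp
qed

theorem theorem10p1:
  shows "\<exists>\<beta>\<^sub>0 :: real.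
    (\<lambda>n. beta_Gnp n (1/2) / real n) \<longlonglongrightarrow> \<beta>\<^sub>0 \<and>
    \<bar>\<beta>\<^sub>0 - 0.672008\<bar> < 5 / 10 ^ 7 \<and>
    (\<lambda>n. beta_ev n / real n) \<longlonglongrightarrow> \<beta>\<^sub>0 \<and>
    beta_ev \<sim>[sequentially] (\<lambda>n. \<beta>\<^sub>0 * real n)"
proof -
  obtain \<zeta> where \<zeta>: "0 < \<zeta>" "\<zeta> < 2" "\<bar>1 / \<zeta> - 0.672008\<bar> < 5 / 10 ^ 7" "dexp \<zeta> = 0"
    by (rule dexp_root)
  have "w < 1" if "\<bar>w - 0.672008\<bar> < 5 / 10 ^ 7" for w :: real
    using that unfolding abs_less_iff by simp
  from this[OF \<zeta>(3)] have range: "0 < 1 / \<zeta>" "1 / \<zeta> < 1" using \<zeta>(1) by simp_all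
  have lim_Gnp: "(\<lambda>n. beta_Gnp n (1/2) / real n) \<longlonglongrightarrow> 1 / \<zeta>"
  proof (rule metric_LIMSEQ_I)
    fix r :: real assume "r > 0"
    then obtain \<delta> where \<delta>: "\<delta> > 0" and
      near: "\<And>n p m g. n > 0 \<Longrightarrow> (\<And>x. x > 0 \<Longrightarrow> poly p x = x ^ m * g (1 / x)) \<Longrightarrow> continuous_on UNIV g \<Longrightarrow>
        (\<And>z. z \<in> {0..2} \<Longrightarrow> \<bar>g (z / real n) - dexp z\<bar> < \<delta>) \<Longrightarrow>
        \<bar>largest_real_root p / real n - 1 / \<zeta>\<bar> \<le> r / 2"
      using largest_real_root_near[OF \<zeta>(1,2,4), of "r / 2"] by auto
    have "\<forall>\<^sub>F n in sequentially. dist (beta_Gnp n (1/2) / real n) (1 / \<zeta>) < r"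
      using mean_clique_poly_uniform_limit[OF \<delta>] eventually_gt_at_top[of 0]
    proof eventually_elim
      case (elim n)
      have "\<bar>largest_real_root (PC_Gnp n (1/2)) / real n - 1 / \<zeta>\<bar> \<le> r / 2"
        by (rule near[of n _ n "mean_clique_poly n", OF elim(2) poly_PC_Gnp_half continuous_mean_clique_poly])
          (use elim in auto)
      then show ?case using \<open>r > 0\<close> by (simp add: beta_Gnp_def dist_real_def)
    qed
    then show "\<exists>N. \<forall>n\<ge>N. dist (beta_Gnp n (1/2) / real n) (1 / \<zeta>) < r"
      by (simp add: eventually_sequentially)
  qed
  have lim_ev: "(\<lambda>n. beta_ev n / real n) \<longlonglongrightarrow> 1 / \<zeta>"
  proof (rule metric_LIMSEQ_I)
    fix r :: real assume "r > 0"
    then obtain \<delta> where \<delta>: "\<delta> > 0" and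
      near: "\<And>n p m g. n > 0 \<Longrightarrow> (\<And>x. x > 0 \<Longrightarrow> poly p x = x ^ m * g (1 / x)) \<Longrightarrow> continuous_on UNIV g \<Longrightarrow>
        (\<And>z. z \<in> {0..2} \<Longrightarrow> \<bar>g (z / real n) - dexp z\<bar> < \<delta>) \<Longrightarrow>
        \<bar>largest_real_root p / real n - 1 / \<zeta>\<bar> \<le> r / 2"
      using largest_real_root_near[OF \<zeta>(1,2,4), of "r / 2"] by auto
    have "(\<lambda>n. 2 / \<delta> * (2 * exp 2 / sqrt (real n))) \<longlonglongrightarrow> 2 / \<delta> * 0"
      by (intro tendsto_mult tendsto_const tendsto_divide_0[OF tendsto_const]
          filterlim_at_top_imp_at_infinity filterlim_compose[OF sqrt_at_top filterlim_real_sequentially])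
    then have "\<forall>\<^sub>F n in sequentially. 2 / \<delta> * (2 * exp 2 / sqrt (real n)) < r / 2"
      using \<open>r > 0\<close> by (intro order_tendstoD(2)) auto
    moreover have "\<delta> / 2 > 0" using \<delta> by simp
    note mean_clique_poly_uniform_limit[OF this]
    moreover note eventually_gt_at_top[of 0]
    ultimately have "\<forall>\<^sub>F n in sequentially. dist (beta_ev n / real n) (1 / \<zeta>) < r"
    proof eventually_elim
      case (elim n)
      have "\<bar>beta {..<n} E / real n - 1 / \<zeta>\<bar> \<le> r / 2 + 2 / \<delta> * clique_deviation n E" for E
      \<comment> \<open>One half of \<delta> is spent on the distance from graph to mean, the other
        on that from mean to limit. If the deviation is larger, \<open>2 / \<delta>\<close> times it
        is at least 1, which covers the trivial error as in Markov's inequality.\<close>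
      proof (cases "clique_deviation n E < \<delta> / 2")
        case True
        have close: "\<bar>clique_poly {..<n} E (z / real n) - dexp z\<bar> < \<delta>" if "z \<in> {0..2}" for z
          using clique_poly_near_mean[OF that, of n E] elim(2)[rule_format, OF that] True by linarith
        have "\<bar>beta {..<n} E / real n - 1 / \<zeta>\<bar> \<le> r / 2"
          unfolding beta_def
          by (rule near[of n _ "clique_number {..<n} E" "clique_poly {..<n} E",
                OF elim(3) poly_PC[OF finite_lessThan] continuous_clique_poly])
            (assumption | erule close)+
        moreover have "0 \<le> 2 / \<delta> * clique_deviation n E"
          using \<delta> by (simp add: clique_deviation_def sum_nonneg)
        ultimately show ?thesis by linarith
      next
        case False
        have "{..<n} \<noteq> {}" using elim(3) by blast
        then have "0 \<le> beta {..<n} E / real n" "beta {..<n} E / real n \<le> 1"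
          using beta_bounds[of "{..<n}" E] elim(3) by (auto simp del: lessThan_empty_iff)
        then have "\<bar>beta {..<n} E / real n - 1 / \<zeta>\<bar> \<le> 1" using range by linarith
        also have "1 \<le> 2 / \<delta> * clique_deviation n E" using False \<delta> by (simp add: field_simps)
        finally show ?thesis using \<open>r > 0\<close> by simp
      qed
      then have "\<bar>beta_ev n / real n - 1 / \<zeta>\<bar> \<le> r / 2 + 2 / \<delta> * (2 * exp 2 / sqrt (real n))"
        using \<delta> by (intro beta_ev_near[OF elim(3)]) auto
      then show ?case using elim(1) unfolding dist_real_def by linarith
    qed
    then show "\<exists>N. \<forall>n\<ge>N. dist (beta_ev n / real n) (1 / \<zeta>) < r"
      by (simp add: eventually_sequentially)
  qed
  have "(\<lambda>n. beta_ev n / real n / (1 / \<zeta>)) \<longlonglongrightarrow> 1 / \<zeta> / (1 / \<zeta>)"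
    by (intro tendsto_divide lim_ev tendsto_const) (use range in auto)
  then have "beta_ev \<sim>[sequentially] (\<lambda>n. 1 / \<zeta> * real n)"
    using \<zeta>(1) by (intro asymp_equivI') (simp add: mult_ac)
  with lim_Gnp lim_ev \<zeta>(3) show ?thesis by blast
qed

end
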